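(* Let $\mathcal{P}$ and $\mathcal{Q}$ be a pair of compactness-like topological properties. Let $X$ be a Tychonoff space with $\mathcal{Q}$. The following are equivalent: (1) $X$ has a countable-point minimal $\mathcal P$-extension with $\mathcal Q$. (2) $X$ has a countable-point optimal $\mathcal P$-extension with $\mathcal Q$. (3) $X$ has a countable-point tight $\mathcal P$-extension with compact remainder with $\mathcal Q$.
   Context: Conventions: compact spaces and Tychonoff spaces are Hausdorff. "Countable" means countably infinite. Topological properties are assumed to be satisfied by at least one space. A mapping $f:X\to Y$ is perfect if $X$ is Hausdorff and $f$ is continuous, closed (not necessarily surjective) and has compact fibers. A topological property $\mathcal{P}$ is invariant (inverse invariant) under perfect mappings if for every perfect surjective $f:X\to Y$, $Y$ has $\mathcal P$ whenever $X$ does ($X$ has $\mathcal P$ whenever $Y$ does); it is perfect if both hold. $\mathcal P$ is clopen hereditary if every clopen subset of a space with $\mathcal P$ has $\mathcal P$; finitely additive if $X_1\oplus\cdots\oplus X_n$ has $\mathcal P$ whenever every $X_i$ does. $\mathcal P$ satisfies Mrówka's condition (W) if: whenever $X$ is a Tychonoff space having a point $p$ with an open base $\mathscr B$ for $X$ at $p$ such that $X\setminus B$ has $\mathcal P$ for every $B\in\mathscr B$, then $X$ has $\mathcal P$. $\mathcal P$ is compactness-like if it is clopen hereditary, finitely additive, perfect and satisfies (W). "$\mathcal P$ and $\mathcal Q$ is a pair of compactness-like topological properties" (order matters) means: $\mathcal P$ is compactness-like, and $\mathcal Q$ is clopen hereditary, inverse invariant under perfect mappings and satisfies (W). A space $Y$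 is an extension of $X$ if it contains $X$ as a dense subspace; $Y\setminus X$ is its remainder; $Y$ is a $\mathcal P$-extension if it has $\mathcal P$; it is a countable-point extension if its remainder is countable. Let $\mathscr E_{\mathcal P}(X)$ be the set of all Tychonoff $\mathcal P$-extensions of $X$ with compact remainder. A minimal $\mathcal P$-extension of $X$ is a $Y\in\mathscr E_{\mathcal P}(X)$ which does not properly contain (as a subspace) any other element of $\mathscr E_{\mathcal P}(X)$. An optimal $\mathcal P$-extension of $X$ is a minimal $\mathcal P$-extension $Y$ whose topology is moreover maximal (with respect to inclusion) among all topologies on the set $Y$ which turn $Y$ into an element of $\mathscr E_{\mathcal P}(X)$. A Tychonoff $\mathcal P$-extension of $X$ is tight if it does not properly contain (as a subspace) any other $\mathcal P$-extension of $X$. *)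

theory Defs
  imports "HOL-Analysis.Analysis"
begin

text \<open>
  A topological property is a predicate on topologies whose points are taken from an arbitrary
  but fixed type, which plays the role of the universe of points.  The carrier of a space is its
  \<open>topspace\<close>, so this covers spaces of every cardinality up to that of the type, including the
  empty space.
\<close>

subsection \<open>Topological properties\<close>

definition topological_property :: "('a topology \<Rightarrow> bool) \<Rightarrow> bool" where
  "topological_property P \<longleftrightarrow>
     (\<exists>S. P S) \<and> (\<forall>S T. S homeomorphic_space T \<longrightarrow> P S \<longrightarrow> P T)"

definition tychonoff_space :: "'a topology \<Rightarrow> bool" where
  "tychonoff_space X \<longleftrightarrow> completely_regular_space X \<and> Hausdorff_space X"

text \<open>
  The library's \<^const>\<open>proper_map\<close> says closed with compact fibres.  The library's
  \<^const>\<open>perfect_map\<close> is not used because it includes surjectivity and omits the Hausdorff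
  requirement on the domain.
\<close>

definition perfect_mapping :: "'a topology \<Rightarrow> 'b topology \<Rightarrow> ('a \<Rightarrow> 'b) \<Rightarrow> bool" where
  "perfect_mapping X Y f \<longleftrightarrow> Hausdorff_space X \<and> continuous_map X Y f \<and> proper_map X Y f"

definition perfect_invariant :: "('a topology \<Rightarrow> bool) \<Rightarrow> bool" where
  "perfect_invariant P \<longleftrightarrow>
     (\<forall>X Y f. perfect_mapping X Y f \<and> f ` topspace X = topspace Y \<longrightarrow> P X \<longrightarrow> P Y)"

definition perfect_inverse_invariant :: "('a topology \<Rightarrow> bool) \<Rightarrow> bool" where
  "perfect_inverse_invariant P \<longleftrightarrow>
     (\<forall>X Y f. perfect_mapping X Y f \<and> f ` topspace X = topspace Y \<longrightarrow> P Y \<longrightarrow> P X)"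

definition perfect_property :: "('a topology \<Rightarrow> bool) \<Rightarrow> bool" where
  "perfect_property P \<longleftrightarrow> perfect_invariant P \<and> perfect_inverse_invariant P"

definition clopen_hereditary :: "('a topology \<Rightarrow> bool) \<Rightarrow> bool" where
  "clopen_hereditary P \<longleftrightarrow>
     (\<forall>X A. P X \<and> openin X A \<and> closedin X A \<longrightarrow> P (subtopology X A))"

text \<open>
  \<^const>\<open>sum_topology\<close> lives on a type of pairs, so the disjoint sum is represented by an
  arbitrary homeomorphic copy \<open>S\<close> of it in the universe of points.
\<close>

definition finitely_additive :: "('a topology \<Rightarrow> bool) \<Rightarrow> bool" where
  "finitely_additive P \<longleftrightarrow>
     (\<forall>(n::nat) X S. n \<ge> 1 \<and> (\<forall>i\<in>{1..n}. P (X i)) \<and>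
        S homeomorphic_space sum_topology X {1..n} \<longrightarrow> P S)"

definition open_base_at :: "'a topology \<Rightarrow> 'a \<Rightarrow> 'a set set \<Rightarrow> bool" where
  "open_base_at X p \<B> \<longleftrightarrow>
     (\<forall>B\<in>\<B>. openin X B \<and> p \<in> B) \<and>
     (\<forall>U. openin X U \<and> p \<in> U \<longrightarrow> (\<exists>B\<in>\<B>. B \<subseteq> U))"

definition mrowka_W :: "('a topology \<Rightarrow> bool) \<Rightarrow> bool" where
  "mrowka_W P \<longleftrightarrow>
     (\<forall>X. tychonoff_space X \<and>
        (\<exists>p\<in>topspace X. \<exists>\<B>. open_base_at X p \<B> \<and>
           (\<forall>B\<in>\<B>. P (subtopology X (topspace X - B))))
        \<longrightarrow> P X)"

definition compactness_like :: "('a topology \<Rightarrow> bool) \<Rightarrow> bool" where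
  "compactness_like P \<longleftrightarrow>
     topological_property P \<and> clopen_hereditary P \<and> finitely_additive P \<and>
     perfect_property P \<and> mrowka_W P"

definition compactness_like_pair ::
    "('a topology \<Rightarrow> bool) \<Rightarrow> ('a topology \<Rightarrow> bool) \<Rightarrow> bool" where
  "compactness_like_pair P Q \<longleftrightarrow>
     compactness_like P \<and>
     topological_property Q \<and> clopen_hereditary Q \<and> perfect_inverse_invariant Q \<and> mrowka_W Q"

subsection \<open>Extensions\<close>

definition extension_of :: "'a topology \<Rightarrow> 'a topology \<Rightarrow> bool" where
  "extension_of X Y \<longleftrightarrow>
     topspace X \<subseteq> topspace Y \<and> subtopology Y (topspace X) = X \<and>
     Y closure_of topspace X = topspace Y"

definition remainder :: "'a topology \<Rightarrow> 'a topology \<Rightarrow> 'a set" where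
  "remainder X Y = topspace Y - topspace X"

text \<open>``Countable'' means countably infinite.\<close>

definition countable_point :: "'a topology \<Rightarrow> 'a topology \<Rightarrow> bool" where
  "countable_point X Y \<longleftrightarrow> countable (remainder X Y) \<and> infinite (remainder X Y)"

definition compact_remainder :: "'a topology \<Rightarrow> 'a topology \<Rightarrow> bool" where
  "compact_remainder X Y \<longleftrightarrow> compactin Y (remainder X Y)"

definition P_extension :: "('a topology \<Rightarrow> bool) \<Rightarrow> 'a topology \<Rightarrow> 'a topology \<Rightarrow> bool" where
  "P_extension P X Y \<longleftrightarrow> extension_of X Y \<and> P Y"

definition E_set :: "('a topology \<Rightarrow> bool) \<Rightarrow> 'a topology \<Rightarrow> 'a topology set" where
  "E_set P X = {Y. P_extension P X Y \<and> tychonoff_space Y \<and> compact_remainder X Y}"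

definition proper_subspace :: "'a topology \<Rightarrow> 'a topology \<Rightarrow> bool" where
  "proper_subspace Z Y \<longleftrightarrow> topspace Z \<subset> topspace Y \<and> Z = subtopology Y (topspace Z)"

definition minimal_extension ::
    "('a topology \<Rightarrow> bool) \<Rightarrow> 'a topology \<Rightarrow> 'a topology \<Rightarrow> bool" where
  "minimal_extension P X Y \<longleftrightarrow>
     Y \<in> E_set P X \<and> \<not> (\<exists>Z \<in> E_set P X. proper_subspace Z Y)"

definition optimal_extension ::
    "('a topology \<Rightarrow> bool) \<Rightarrow> 'a topology \<Rightarrow> 'a topology \<Rightarrow> bool" where
  "optimal_extension P X Y \<longleftrightarrow>
     minimal_extension P X Y \<and>
     (\<forall>Z \<in> E_set P X. topspace Z = topspace Y \<and> {U. openin Y U} \<subseteq> {U. openin Z U}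
        \<longrightarrow> Z = Y)"

definition tight_extension ::
    "('a topology \<Rightarrow> bool) \<Rightarrow> 'a topology \<Rightarrow> 'a topology \<Rightarrow> bool" where
  "tight_extension P X Y \<longleftrightarrow>
     P_extension P X Y \<and> tychonoff_space Y \<and>
     \<not> (\<exists>Z. P_extension P X Z \<and> proper_subspace Z Y)"

end

theory Submission
  imports Defs
begin

text \<open>
  Let \<open>Y\<close> be a minimal \<open>P\<close>-extension with countably infinite compact remainder \<open>K\<close>.  By the Baire
  category theorem \<open>K\<close> has infinitely many isolated points; choose distinct ones \<open>q 0\<close>, \<open>q 1\<close> and so on.
  Identify all of \<open>K\<close> except \<open>q 1\<close>, \<open>q 2\<close> and so on with \<open>q 0\<close>, so that the remainder becomes a
  sequence converging to \<open>q 0\<close>, and refine the topology as much as possible by removing sets that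
  are negligible for \<open>P\<close> from the neighbourhoods of the points \<open>q n\<close>.  The resulting space \<open>W\<close> has
  \<open>P\<close> by repeated use of condition (W): its closed subsets with finitely many points in the
  remainder have \<open>P\<close>, hence so does \<open>W\<close>; the same argument gives \<open>Q\<close> for \<open>W\<close> from \<open>Q\<close> for \<open>X\<close>.
  By minimality of \<open>Y\<close>, no neighbourhood of an isolated point \<open>q n\<close> is negligible, so no
  \<open>q n\<close> can be omitted from \<open>W\<close>, not even by an extension with noncompact remainder.  This
  works for the limit point \<open>q 0\<close> only because an isolated point of \<open>K\<close> was merged into it.
\<close>

subsection \<open>Closed subspaces and unions of two closed subspaces\<close>

text \<open>For infinite \<open>'a\<close>, cardinal arithmetic gives \<open>nat \<times> 'a\<close>
  the size of \<open>'a\<close>. The injection allows a finite sum, whose points are pairs, to be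
  copied back into the type of points.\<close>

lemma inj_nat_Times:
  assumes "infinite (UNIV::'a set)"
  shows "\<exists>e :: nat \<times> 'a \<Rightarrow> 'a. inj e"
proof -
  include cardinal_syntax
  have "|UNIV :: nat set| \<le>o |UNIV :: 'a set|"
    using assms infinite_iff_card_of_nat by blast
  then have "|(UNIV :: nat set) \<times> (UNIV :: 'a set)| =o |UNIV :: 'a set|"
    using card_of_Times_infinite[OF assms, of "UNIV :: nat set"] by simp
  then have "|(UNIV :: nat set) \<times> (UNIV :: 'a set)| \<le>o |UNIV :: 'a set|"
    by (rule ordIso_imp_ordLeq)
  then show ?thesis
    unfolding card_of_ordLeq[symmetric] by auto
qed

text \<open>The copy is the pullback of \<open>T\<close> along the inverse of \<open>e\<close>,
  carried by the image of \<open>e\<close>.\<close>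

lemma homeomorphic_copy:
  fixes e :: "'b \<Rightarrow> 'a"
  assumes "inj_on e (topspace T)"
  shows "\<exists>S :: 'a topology. S homeomorphic_space T"
proof -
  let ?i = "inv_into (topspace T) e"
  define S where "S = pullback_topology (e ` topspace T) ?i T"
  have ie: "?i (e x) = x" if "x \<in> topspace T" for x
    using assms that by simp
  have tS: "topspace S = e ` topspace T"
    unfolding S_def topspace_pullback_topology using ie by auto
  have "continuous_map S T (id \<circ> ?i)"
    unfolding S_def using continuous_map_pullback[of T T id] by simp
  moreover have "continuous_map T S e"
    unfolding S_def
  proof (rule continuous_map_pullback')
    show "continuous_map T T (?i \<circ> e)"
      by (rule continuous_map_eq[OF continuous_map_id]) (simp add: ie)
  qed auto
  ultimately have "homeomorphic_maps S T ?i e"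
    unfolding homeomorphic_maps_def using tS ie by (auto simp: f_inv_into_f)
  then show ?thesis
    unfolding homeomorphic_space_def by blast
qed

text \<open>Both halves rest on finiteness of \<open>I\<close>: an image is a finite union of closed
  slices, and a fibre has at most one point per index.\<close>

lemma proper_map_snd_sum_topology:
  assumes "finite I" "\<And>i. i \<in> I \<Longrightarrow> closedin T (C i)"
  shows "proper_map (sum_topology (\<lambda>i. subtopology T (C i)) I) (subtopology T (\<Union>i\<in>I. C i)) snd"
  unfolding proper_map_def
proof
  let ?S = "sum_topology (\<lambda>i. subtopology T (C i)) I"
  show "closed_map ?S (subtopology T (\<Union>i\<in>I. C i)) snd"
    unfolding closed_map_def
  proof (intro allI impI)
    fix U assume U: "closedin ?S U"
    then have c: "closedin T {x. (i, x) \<in> U}" if "i \<in> I" for i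
      using that assms(2)[OF that] unfolding closedin_sum_topology
      by (auto intro: closedin_trans_full)
    have eq: "snd ` U = (\<Union>i\<in>I. {x. (i, x) \<in> U})"
      using closedin_subset[OF U] by force
    have "closedin T (snd ` U)"
      unfolding eq using assms(1) c by (auto intro: closedin_Union)
    moreover have "snd ` U \<subseteq> (\<Union>i\<in>I. C i)"
      using closedin_subset[OF U] by force
    ultimately show "closedin (subtopology T (\<Union>i\<in>I. C i)) (snd ` U)"
      by (simp add: closedin_subset_topspace)
  qed
  show "\<forall>y\<in>topspace (subtopology T (\<Union>i\<in>I. C i)). compactin ?S {x \<in> topspace ?S. snd x = y}"
  proof
    fix y
    have "{x \<in> topspace ?S. snd x = y} \<subseteq> (\<lambda>i. (i, y)) ` I"
      by force
    then have "finite {x \<in> topspace ?S. snd x = y}"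
      using assms(1) finite_surj by blast
    then show "compactin ?S {x \<in> topspace ?S. snd x = y}"
      by (intro finite_imp_compactin) auto
  qed
qed

lemma continuous_map_snd_sum_topology:
  "continuous_map (sum_topology (\<lambda>i. subtopology T (C i)) I) (subtopology T (\<Union>i\<in>I. C i)) snd"
proof -
  let ?S = "sum_topology (\<lambda>i. subtopology T (C i)) I"
  have "openin ?S {x \<in> topspace ?S. snd x \<in> U}" if "openin T U" for U
    unfolding openin_sum_topology
  proof (intro conjI ballI)
    fix i assume "i \<in> I"
    then have "{x. (i, x) \<in> {x \<in> topspace ?S. snd x \<in> U}} = U \<inter> C i"
      using openin_subset[OF that] by auto
    then show "openin (subtopology T (C i)) {x. (i, x) \<in> {x \<in> topspace ?S. snd x \<in> U}}"
      using that by (simp add: openin_subtopology_Int)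
  qed auto
  then show ?thesis
    unfolding continuous_map_in_subtopology continuous_map_def[of _ T] by (auto simp: Pi_iff)
qed

text \<open>Distinct points with equal second coordinate lie in different summands, which are open;
  other pairs are separated by preimages of open sets of \<open>T\<close>.\<close>

lemma Hausdorff_sum_subtopology:
  assumes "Hausdorff_space T"
  shows "Hausdorff_space (sum_topology (\<lambda>i. subtopology T (C i)) I)" (is "Hausdorff_space ?S")
  unfolding Hausdorff_space_def
proof (intro allI impI)
  fix x y assume xy: "x \<in> topspace ?S \<and> y \<in> topspace ?S \<and> x \<noteq> y"
  show "\<exists>U V. openin ?S U \<and> openin ?S V \<and> x \<in> U \<and> y \<in> V \<and> disjnt U V"
  proof (cases "snd x = snd y")
    case True
    then have ne: "fst x \<noteq> fst y"
      using xy by (auto simp: prod_eq_iff)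
    have o: "openin ?S ({i} \<times> topspace (subtopology T (C i)))" if "i \<in> I" for i
    proof -
      have "openin ?S (Pair i ` topspace (subtopology T (C i)))"
        using open_map_component_injection[OF that, of "\<lambda>i. subtopology T (C i)"]
        unfolding open_map_def by blast
      moreover have "Pair i ` topspace (subtopology T (C i)) = {i} \<times> topspace (subtopology T (C i))"
        by auto
      ultimately show ?thesis by simp
    qed
    let ?U = "\<lambda>z. {fst z} \<times> topspace (subtopology T (C (fst z)))"
    have "openin ?S (?U x)" "openin ?S (?U y)" "x \<in> ?U x" "y \<in> ?U y" "disjnt (?U x) (?U y)"
      using xy ne by (auto simp: disjnt_def intro!: o simp del: topspace_subtopology)
    then show ?thesis
      by (intro exI[of _ "?U x"] exI[of _ "?U y"] conjI)
  next
    case False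
    have "snd z \<in> topspace T" if "z \<in> topspace ?S" for z
      using that by (cases z) simp
    then have "snd x \<in> topspace T" "snd y \<in> topspace T"
      using xy by blast+
    then have "\<exists>U V. openin T U \<and> openin T V \<and> snd x \<in> U \<and> snd y \<in> V \<and> disjnt U V"
      using assms False unfolding Hausdorff_space_def by blast
    then obtain U V where UV: "openin T U" "openin T V" "snd x \<in> U" "snd y \<in> V" "disjnt U V"
      by blast
    have c: "continuous_map ?S T snd"
      using continuous_map_snd_sum_topology[of T C I] by (simp add: continuous_map_in_subtopology)
    let ?W = "\<lambda>U. {z \<in> topspace ?S. snd z \<in> U}"
    have "openin ?S (?W U)" "openin ?S (?W V)"
      using openin_continuous_map_preimage[OF c] UV by blast+
    moreover have "x \<in> ?W U" "y \<in> ?W V" "disjnt (?W U) (?W V)"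
      using UV xy by (auto simp: disjnt_def)
    ultimately show ?thesis by blast
  qed
qed

text \<open>One device with two uses: read backwards it leads from a space to a closed subspace,
  read forwards from two closed sets to their union.\<close>

lemma sum_copy_perfect_mapping:
  fixes T :: "'a topology"
  assumes "infinite (UNIV::'a set)" "Hausdorff_space T" "finite I" "\<And>i::nat. i \<in> I \<Longrightarrow> closedin T (C i)"
  obtains S :: "'a topology" and f
  where "S homeomorphic_space sum_topology (\<lambda>i. subtopology T (C i)) I"
    and "perfect_mapping S (subtopology T (\<Union>i\<in>I. C i)) f"
    and "f ` topspace S = topspace (subtopology T (\<Union>i\<in>I. C i))"
proof -
  let ?D = "sum_topology (\<lambda>i. subtopology T (C i)) I"
  obtain e :: "nat \<times> 'a \<Rightarrow> 'a" where "inj e"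
    using inj_nat_Times[OF assms(1)] by blast
  then obtain S :: "'a topology" where S: "S homeomorphic_space ?D"
    using homeomorphic_copy[of e ?D] by (meson inj_on_subset subset_UNIV)
  then obtain k where k: "homeomorphic_map S ?D k"
    by (auto simp: homeomorphic_space)
  show thesis
  proof (rule that)
    show "S homeomorphic_space ?D" by fact
    show "perfect_mapping S (subtopology T (\<Union>i\<in>I. C i)) (snd \<circ> k)"
      unfolding perfect_mapping_def
    proof (intro conjI)
      show "Hausdorff_space S"
        using Hausdorff_sum_subtopology[OF assms(2)] S homeomorphic_Hausdorff_space by blast
      show "continuous_map S (subtopology T (\<Union>i\<in>I. C i)) (snd \<circ> k)"
        using k continuous_map_snd_sum_topology continuous_map_compose homeomorphic_imp_continuous_map
        by blast
      show "proper_map S (subtopology T (\<Union>i\<in>I. C i)) (snd \<circ> k)"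
        by (rule proper_map_compose[OF homeomorphic_imp_proper_map[OF k]
              proper_map_snd_sum_topology[OF assms(3,4)]])
    qed
    have "snd ` topspace ?D = topspace (subtopology T (\<Union>i\<in>I. C i))"
      by (force simp: image_iff)
    then show "(snd \<circ> k) ` topspace S = topspace (subtopology T (\<Union>i\<in>I. C i))"
      using homeomorphic_imp_surjective_map[OF k] unfolding image_comp[symmetric] by simp
  qed
qed

lemma topological_property_homeomorphic:
  assumes "topological_property P" "S homeomorphic_space T" "P S"
  shows "P T"
  using assms unfolding topological_property_def by blast

text \<open>The inclusion of \<open>A\<close> and the identity together map \<open>A \<oplus> T\<close> perfectly onto \<open>T\<close>.\<close>

lemma closed_hereditary:
  fixes T :: "'a topology"
  assumes "infinite (UNIV::'a set)" "topological_property P" "clopen_hereditary P"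
    "perfect_inverse_invariant P" "Hausdorff_space T" "P T" "closedin T A"
  shows "P (subtopology T A)"
proof -
  \<comment> \<open>Index 2 carries all of \<open>T\<close>, so the projection of the sum is onto
    \<open>T\<close>.\<close>
  define C where "C = (\<lambda>i::nat. if i = 1 then A else topspace T)"
  have two: "{1..2::nat} = {1, 2}" by auto
  have U: "(\<Union>i\<in>{1..2}. C i) = topspace T"
    using closedin_subset[OF assms(7)] unfolding two by (auto simp: C_def)
  let ?D = "sum_topology (\<lambda>i. subtopology T (C i)) {1..2}"
  have "closedin T (C i)" for i
    using assms(7) by (simp add: C_def)
  then obtain S :: "'a topology" and f where S: "S homeomorphic_space ?D"
    "perfect_mapping S T f" "f ` topspace S = topspace T"
    using sum_copy_perfect_mapping[OF assms(1,5) finite_atLeastAtMost, of 1 2 C]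
    unfolding U subtopology_topspace by metis
  then have "P S"
    using assms(4,6) unfolding perfect_inverse_invariant_def by blast
  obtain k where k: "homeomorphic_map S ?D k"
    using S(1) by (auto simp: homeomorphic_space)
  \<comment> \<open>\<open>B\<close> is the summand \<open>A\<close>, clopen in the sum; its
    preimage \<open>B'\<close> under \<open>k\<close> is a clopen copy of \<open>A\<close> in
    \<open>S\<close>.\<close>
  define B where "B = Pair (1::nat) ` (topspace T \<inter> A)"
  have one: "(1::nat) \<in> {1..2}" by simp
  have hB: "subtopology T A homeomorphic_space subtopology ?D B"
    using embedding_map_imp_homeomorphic_space[OF embedding_map_component_injection[OF one, of "\<lambda>i. subtopology T (C i)"]]
    by (simp add: C_def B_def)
  have Bi: "{x. (i, x) \<in> B} = (if i = 1 then topspace T \<inter> A else {})" for i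
    by (auto simp: B_def)
  have "A \<subseteq> topspace T"
    using assms(7) closedin_subset by blast
  then have B: "openin ?D B" "closedin ?D B"
    unfolding openin_sum_topology closedin_sum_topology Bi
    using openin_topspace[of "subtopology T A"] closedin_topspace[of "subtopology T A"]
    by (auto simp: B_def C_def)
  define B' where "B' = {x \<in> topspace S. k x \<in> B}"
  have "openin S B'" "closedin S B'"
    unfolding B'_def using homeomorphic_imp_continuous_map[OF k] B
      openin_continuous_map_preimage closedin_continuous_map_preimage by blast+
  then have "P (subtopology S B')"
    using assms(3) \<open>P S\<close> unfolding clopen_hereditary_def by blast
  moreover have "homeomorphic_map (subtopology S B') (subtopology ?D B) k"
  proof (rule homeomorphic_map_subtopologies_alt[OF k])
    show "k x \<in> B \<longleftrightarrow> x \<in> B'" if "x \<in> topspace S" for x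
      using that by (simp add: B'_def)
  qed
  then have "subtopology S B' homeomorphic_space subtopology T A"
    using hB homeomorphic_map_imp_homeomorphic_space homeomorphic_space_sym homeomorphic_space_trans
    by blast
  ultimately show ?thesis
    using assms(2) topological_property_homeomorphic by blast
qed

text \<open>The sum of \<open>A\<close> and \<open>B\<close> has \<open>P\<close> by finite
  additivity and maps perfectly onto the union.\<close>

lemma closed_Un:
  fixes T :: "'a topology"
  assumes "infinite (UNIV::'a set)" "compactness_like P" "Hausdorff_space T"
    "closedin T A" "closedin T B" "P (subtopology T A)" "P (subtopology T B)"
  shows "P (subtopology T (A \<union> B))"
proof -
  define C where "C = (\<lambda>i::nat. if i = 1 then A else B)"
  have two: "{1..2::nat} = {1, 2}" by auto
  have U: "(\<Union>i\<in>{1..2}. C i) = A \<union> B"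
    unfolding two by (auto simp: C_def)
  have "closedin T (C i)" for i
    using assms by (simp add: C_def)
  then obtain S :: "'a topology" and f
    where S: "S homeomorphic_space sum_topology (\<lambda>i. subtopology T (C i)) {1..2}"
      "perfect_mapping S (subtopology T (A \<union> B)) f" "f ` topspace S = topspace (subtopology T (A \<union> B))"
    using sum_copy_perfect_mapping[OF assms(1,3) finite_atLeastAtMost, of 1 2 C]
    unfolding U by metis
  have "P (subtopology T (C i))" for i
    using assms by (simp add: C_def)
  moreover have "finitely_additive P"
    using assms(2) by (simp add: compactness_like_def)
  ultimately have "P S"
    using S(1) unfolding finitely_additive_def
    by (elim allE[of _ 2] allE[of _ "\<lambda>i. subtopology T (C i)"] allE[of _ S]) simp
  then show ?thesis
    using S assms(2) unfolding compactness_like_def perfect_property_def perfect_invariant_def by blast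
qed

text \<open>Some space has \<open>P\<close>, its empty subset is clopen, and only one topology has
  empty carrier.\<close>

lemma empty_space:
  assumes "topological_property P" "clopen_hereditary P" "topspace T = {}"
  shows "P T"
proof -
  obtain S where "P S"
    using assms(1) by (auto simp: topological_property_def)
  then have "P (subtopology S {})"
    using assms(2) openin_empty closedin_empty unfolding clopen_hereditary_def by metis
  moreover have "subtopology S {} = T"
    using assms(3) null_topspace_iff_trivial[of T] null_topspace_iff_trivial[of "subtopology S {}"] by simp
  ultimately show ?thesis by simp
qed

subsection \<open>Isolated points and initial topologies\<close>

text \<open>If the isolated points were finite in number, removing them would leave a nonempty
  clopen set without isolated points. Such a perfect set in a compact Hausdorff space is at least as
  large as the reals.\<close>

lemma infinite_isolated_points:
  assumes "compact_space K" "Hausdorff_space K" "countable (topspace K)" "infinite (topspace K)"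
  shows "infinite {x. openin K {x}}"
proof
  define F where "F = {x. openin K {x}}"
  assume "finite {x. openin K {x}}"
  then have fF: "finite F" by (simp add: F_def)
  have FK: "F \<subseteq> topspace K"
    using openin_subset by (fastforce simp: F_def)
  define S where "S = topspace K - F"
  have "closedin K F"
    using closedin_Hausdorff_finite[OF assms(2) FK fF] .
  then have oS: "openin K S"
    by (simp add: S_def openin_diff)
  have "openin K (\<Union>x\<in>F. {x})"
    by (intro openin_Union) (auto simp: F_def)
  then have "closedin K S"
    by (simp add: S_def closedin_diff)
  then have "K derived_set_of S \<subseteq> S"
    by (simp add: closedin_contains_derived_set)
  moreover have "S \<subseteq> K derived_set_of S"
  proof
    fix x assume x: "x \<in> S"
    have "\<exists>y. y \<noteq> x \<and> y \<in> S \<and> y \<in> U" if U: "x \<in> U" "openin K U" for U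
    proof (rule ccontr)
      assume "\<not> ?thesis"
      then have "U \<inter> S = {x}" using U x by blast
      then have "openin K {x}" using openin_Int[OF U(2) oS] by simp
      then show False using x by (simp add: S_def F_def)
    qed
    then show "x \<in> K derived_set_of S"
      using x by (auto simp: derived_set_of_def S_def)
  qed
  moreover have "S \<noteq> {}"
    using fF assms(4) unfolding S_def by (metis Diff_eq_empty_iff finite_subset)
  ultimately have "(UNIV::real set) \<lesssim> S"
    using lepoll_perfect_set[of K S] compact_imp_locally_compact_space assms(1,2) by blast
  moreover have "countable S"
    using assms(3) by (simp add: S_def)
  ultimately show False
    by (metis countable_lepoll uncountable_UNIV_real)
qed

text \<open>Inserting \<open>S\<close> into the subbase fixes the carrier even when \<open>F\<close>
  is empty.\<close>

definition initial_topology :: "'a set \<Rightarrow> ('a \<Rightarrow> real) set \<Rightarrow> 'a topology" where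
  "initial_topology S F =
     topology_generated_by (insert S {{y \<in> S. f y \<in> U} |f U. f \<in> F \<and> open U})"

lemma topspace_initial_topology [simp]: "topspace (initial_topology S F) = S"
  by (auto simp: initial_topology_def)

lemma continuous_map_initial_topology:
  assumes "f \<in> F"
  shows "continuous_map (initial_topology S F) euclideanreal f"
  unfolding continuous_map_def
proof (intro conjI allI impI)
  fix U :: "real set" assume "openin euclideanreal U"
  then have "{y \<in> S. f y \<in> U} \<in> insert S {{y \<in> S. f y \<in> U} |f U. f \<in> F \<and> open U}"
    using assms by auto
  then show "openin (initial_topology S F) {x \<in> topspace (initial_topology S F). f x \<in> U}"
    unfolding topspace_initial_topology unfolding initial_topology_def
    by (rule topology_generated_by_Basis)
qed auto

text \<open>The empty set needs no case of its own, being the union of the empty family. The rule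
  reduces claims about neighbourhoods in \<open>W\<close> to single generators.\<close>

lemma openin_initial_topology_induct [consumes 1, case_names space preimage Int Union]:
  assumes "openin (initial_topology S F) O'"
    and "R S"
    and "\<And>f U. f \<in> F \<Longrightarrow> open U \<Longrightarrow> R {y \<in> S. f y \<in> U}"
    and "\<And>A B. R A \<Longrightarrow> R B \<Longrightarrow> R (A \<inter> B)"
    and "\<And>\<U>. (\<And>A. A \<in> \<U> \<Longrightarrow> R A) \<Longrightarrow> R (\<Union>\<U>)"
  shows "R O'"
proof -
  have "generate_topology_on (insert S {{y \<in> S. f y \<in> U} |f U. f \<in> F \<and> open U}) O'"
    using assms(1) by (simp add: initial_topology_def openin_topology_generated_by_iff)
  then show ?thesis
  proof induction
    case Empty
    show ?case using assms(5)[of "{}"] by simp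
  next
    case (UN K)
    then show ?case using assms(5) by blast
  next
    case (Basis s)
    then show ?case using assms(2,3) by blast
  qed (rule assms(4))
qed

text \<open>The separating functions are built along the generation of \<open>V\<close>: a rescaled
  distance for a generator, a maximum for an intersection. Asking only for values of at least 1 off
  \<open>V\<close> keeps this simple; truncation at 1 comes last.\<close>

lemma completely_regular_initial_topology:
  "completely_regular_space (initial_topology S F)"
proof -
  let ?T = "initial_topology S F"
  have *: "\<forall>x\<in>V. \<exists>f. continuous_map ?T euclideanreal f \<and> f x = 0 \<and> (\<forall>y\<in>S - V. f y \<ge> 1)"
    if "openin ?T V" for V
    using that
  proof (induction rule: openin_initial_topology_induct)
    case space
    show ?case by (intro ballI exI[of _ "\<lambda>_. 0"]) auto
  next
    case (preimage f U)
    show ?case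
    proof
      fix x assume "x \<in> {y \<in> S. f y \<in> U}"
      then obtain e where e: "e > 0" "ball (f x) e \<subseteq> U"
        using preimage(2) openE by blast
      let ?g = "\<lambda>y. \<bar>f y - f x\<bar> / e"
      have "continuous_map ?T euclideanreal ?g"
        using e(1) by (intro continuous_intros continuous_map_initial_topology preimage) auto
      moreover have "?g y \<ge> 1" if "y \<in> S - {y \<in> S. f y \<in> U}" for y
      proof -
        have "f y \<notin> ball (f x) e"
          using that e(2) by blast
        then show ?thesis
          using e(1) by (simp add: dist_real_def abs_minus_commute)
      qed
      ultimately show "\<exists>g. continuous_map ?T euclideanreal g \<and> g x = 0 \<and>
          (\<forall>y\<in>S - {y \<in> S. f y \<in> U}. g y \<ge> 1)"
        by (intro exI[of _ ?g]) auto
    qed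
  next
    case (Int A B)
    show ?case
    proof
      fix x assume "x \<in> A \<inter> B"
      then obtain f g where fg: "continuous_map ?T euclideanreal f" "f x = 0" "\<forall>y\<in>S - A. f y \<ge> 1"
        "continuous_map ?T euclideanreal g" "g x = 0" "\<forall>y\<in>S - B. g y \<ge> 1"
        using Int by (metis IntE)
      then show "\<exists>h. continuous_map ?T euclideanreal h \<and> h x = 0 \<and> (\<forall>y\<in>S - A \<inter> B. h y \<ge> 1)"
        by (intro exI[of _ "\<lambda>y. max (f y) (g y)"]) (auto intro: continuous_map_real_max simp: le_max_iff_disj)
    qed
  next
    case (Union \<U>)
    show ?case
    proof
      fix x assume "x \<in> \<Union>\<U>"
      then obtain A where A: "A \<in> \<U>" "x \<in> A" by blast
      then obtain f where "continuous_map ?T euclideanreal f" "f x = 0" "\<forall>y\<in>S - A. f y \<ge> 1"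
        using Union by blast
      then show "\<exists>f. continuous_map ?T euclideanreal f \<and> f x = 0 \<and> (\<forall>y\<in>S - \<Union>\<U>. f y \<ge> 1)"
        using A by blast
    qed
  qed
  show ?thesis
    unfolding completely_regular_space_alt'
  proof (intro allI impI)
    fix V x assume "openin ?T V" "x \<in> V"
    then obtain f where f: "continuous_map ?T euclideanreal f" "f x = 0" "\<forall>y\<in>S - V. f y \<ge> 1"
      using * by blast
    then show "\<exists>f. continuous_map ?T euclideanreal f \<and> f x = 0 \<and> f ` (topspace ?T - V) \<subseteq> {1}"
      by (intro exI[of _ "\<lambda>y. min (f y) 1"] conjI continuous_map_real_min) auto
  qed
qed

lemma Hausdorff_initial_topology:
  assumes "\<And>x y. x \<in> S \<Longrightarrow> y \<in> S \<Longrightarrow> x \<noteq> y \<Longrightarrow> \<exists>f\<in>F. f x \<noteq> f y"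
  shows "Hausdorff_space (initial_topology S F)"
  unfolding Hausdorff_space_def
proof (intro allI impI)
  fix x y assume xy: "x \<in> topspace (initial_topology S F) \<and> y \<in> topspace (initial_topology S F) \<and> x \<noteq> y"
  then have "\<exists>f\<in>F. f x \<noteq> f y"
    by (intro assms) simp_all
  then obtain f where f: "f \<in> F" "f x \<noteq> f y" ..
  then obtain U V where UV: "open U" "open V" "f x \<in> U" "f y \<in> V" "U \<inter> V = {}"
    using hausdorff[OF f(2)] by blast
  let ?P = "\<lambda>U. {z \<in> topspace (initial_topology S F). f z \<in> U}"
  have "openin (initial_topology S F) (?P U)" "openin (initial_topology S F) (?P V)"
    using openin_continuous_map_preimage[OF continuous_map_initial_topology[OF f(1)]] UV by auto
  moreover have "x \<in> ?P U" "y \<in> ?P V" "disjnt (?P U) (?P V)"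
    using UV xy by (auto simp: disjnt_def)
  ultimately show "\<exists>U V. openin (initial_topology S F) U \<and> openin (initial_topology S F) V \<and>
      x \<in> U \<and> y \<in> V \<and> disjnt U V"
    by (intro exI[of _ "?P U"] exI[of _ "?P V"] conjI)
qed

subsection \<open>Sets negligible for a compactness-like property\<close>

locale small_sets =
  fixes P :: "'a topology \<Rightarrow> bool" and X :: "'a topology"
  assumes infinite_UNIV: "infinite (UNIV :: 'a set)"
    and P: "compactness_like P"
    and Hausdorff_X: "Hausdorff_space X"
begin

text \<open>Passing to a closed superset makes the notion hereditary, so that small sets form an
  ideal; for closed sets it reduces to \<open>P\<close> of the subspace.\<close>

definition small :: "'a set \<Rightarrow> bool" where
  "small S \<longleftrightarrow> (\<exists>D. closedin X D \<and> S \<subseteq> D \<and> P (subtopology X D))"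

lemma P_closed:
  assumes "Hausdorff_space T" "P T" "closedin T A"
  shows "P (subtopology T A)"
  using P by (intro closed_hereditary[of P, OF infinite_UNIV _ _ _ assms])
    (simp_all add: compactness_like_def perfect_property_def)

lemma small_mono: "small S \<Longrightarrow> R \<subseteq> S \<Longrightarrow> small R"
  unfolding small_def by (meson order_trans)

lemma small_closed:
  assumes "closedin X S" "small S"
  shows "P (subtopology X S)"
proof -
  obtain D where D: "closedin X D" "S \<subseteq> D" "P (subtopology X D)"
    using assms(2) by (auto simp: small_def)
  have "closedin (subtopology X D) S"
    using assms(1) D(2) by (rule closedin_subset_topspace)
  then have "P (subtopology (subtopology X D) S)"
    using P_closed Hausdorff_space_subtopology[OF Hausdorff_X] D(3) by blast
  then show ?thesis
    using D(2) by (simp add: subtopology_subtopology inf_absorb2)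
qed

lemma small_closed_iff: "closedin X S \<Longrightarrow> small S \<longleftrightarrow> P (subtopology X S)"
  using small_closed unfolding small_def by (metis order_refl)

lemma small_Un:
  assumes "small R" "small S"
  shows "small (R \<union> S)"
proof -
  obtain A B where "closedin X A" "R \<subseteq> A" "P (subtopology X A)"
    "closedin X B" "S \<subseteq> B" "P (subtopology X B)"
    using assms by (auto simp: small_def)
  then have "closedin X (A \<union> B)" "R \<union> S \<subseteq> A \<union> B" "P (subtopology X (A \<union> B))"
    using closed_Un[OF infinite_UNIV P Hausdorff_X, of A B] by auto
  then show ?thesis
    unfolding small_def by (intro exI[of _ "A \<union> B"] conjI)
qed

lemma small_empty: "small {}"
proof -
  have "P (subtopology X {})"
    using P by (auto simp: compactness_like_def intro: empty_space[of P])
  then show ?thesis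
    unfolding small_def by (intro exI[of _ "{}"]) simp
qed

lemma small_UN: "finite I \<Longrightarrow> (\<And>i. i \<in> I \<Longrightarrow> small (S i)) \<Longrightarrow> small (\<Union>i\<in>I. S i)"
  by (induction I rule: finite_induct) (simp_all add: small_empty small_Un)

text \<open>\<open>C\<close> inherits \<open>P\<close> from \<open>Z\<close> as a closed subspace
  and carries the same topology in \<open>X\<close>. This is how \<open>P\<close> of an extension
  yields small sets.\<close>

lemma small_closedin_extension:
  assumes "Hausdorff_space Z" "P Z" "subtopology Z (topspace X) = X" "closedin Z C" "C \<subseteq> topspace X"
  shows "small C"
proof -
  have "closedin (subtopology Z (topspace X)) C"
    using assms(4,5) by (rule closedin_subset_topspace)
  then have "closedin X C"
    using assms(3) by simp
  moreover have "subtopology X C = subtopology Z C"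
    using assms(3,5) by (metis inf_absorb2 subtopology_subtopology)
  ultimately show ?thesis
    using small_closed_iff P_closed[OF assms(1,2,4)] by simp
qed

text \<open>An analogue of the functions vanishing at infinity, with small sets in the role of
  relatively compact ones. The value 0 off \<open>X\<close> extends each function to any
  remainder.\<close>

definition vanishing :: "('a \<Rightarrow> real) set" where
  "vanishing = {g. continuous_map X euclideanreal g \<and> (\<forall>y. y \<notin> topspace X \<longrightarrow> g y = 0) \<and>
     (\<forall>e>0. small {x \<in> topspace X. e \<le> \<bar>g x\<bar>})}"

lemma E_set_D:
  assumes "Z \<in> E_set P X"
  shows "Hausdorff_space Z" "completely_regular_space Z" "P Z" "subtopology Z (topspace X) = X"
    "topspace X \<subseteq> topspace Z" "compactin Z (remainder X Z)" "closedin Z (remainder X Z)"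
    "openin Z (topspace X)" "topspace Z = topspace X \<union> remainder X Z"
proof -
  show *: "Hausdorff_space Z" "completely_regular_space Z" "P Z" "subtopology Z (topspace X) = X"
    "topspace X \<subseteq> topspace Z" "compactin Z (remainder X Z)"
    using assms by (auto simp: E_set_def P_extension_def extension_of_def tychonoff_space_def compact_remainder_def)
  then show c: "closedin Z (remainder X Z)"
    by (simp add: compactin_imp_closedin)
  then show "openin Z (topspace X)"
    using *(5) unfolding closedin_def remainder_def by (simp add: double_diff)
  show "topspace Z = topspace X \<union> remainder X Z"
    using *(5) by (auto simp: remainder_def)
qed

lemma openin_E_set:
  assumes "Z \<in> E_set P X" "openin X U"
  shows "openin Z U"
  using openin_trans_full[of Z "topspace X" U] E_set_D(4,8)[OF assms(1)] assms(2) by simp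

text \<open>For \<open>e > 0\<close> the set where the absolute value of \<open>f\<close> is at
  least \<open>e\<close> is closed in \<open>Z\<close> and misses the remainder, hence is
  small.\<close>

lemma vanishing_on_remainder:
  assumes Z: "Z \<in> E_set P X" and f: "continuous_map Z euclideanreal f"
    and 0: "\<And>y. y \<in> remainder X Z \<Longrightarrow> f y = 0"
  shows "(\<lambda>x. if x \<in> topspace X then f x else 0) \<in> vanishing"
  unfolding vanishing_def
proof (intro CollectI conjI allI impI)
  note Zp = E_set_D[OF Z]
  have "continuous_map X euclideanreal f"
    using continuous_map_from_subtopology[OF f, of "topspace X"] Zp(4) by simp
  then show "continuous_map X euclideanreal (\<lambda>x. if x \<in> topspace X then f x else 0)"
    by (rule continuous_map_eq) simp
  fix e :: real assume "e > 0"
  have eq: "{x \<in> topspace X. e \<le> \<bar>if x \<in> topspace X then f x else 0\<bar>} = {x \<in> topspace Z. \<bar>f x\<bar> \<in> {e..}}"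
    using \<open>e > 0\<close> 0 Zp(9) by auto
  have "closedin Z {x \<in> topspace Z. \<bar>f x\<bar> \<in> {e..}}"
    using f by (intro closedin_continuous_map_preimage[where Y = euclideanreal] continuous_map_real_abs) auto
  moreover have "{x \<in> topspace Z. \<bar>f x\<bar> \<in> {e..}} \<subseteq> topspace X"
    unfolding eq[symmetric] by blast
  ultimately show "small {x \<in> topspace X. e \<le> \<bar>if x \<in> topspace X then f x else 0\<bar>}"
    unfolding eq using small_closedin_extension[OF Zp(1,3,4)] by blast
qed auto

text \<open>\<open>U\<close> is open in \<open>Z\<close> because the compact remainder is closed, so
  complete regularity of \<open>Z\<close> supplies the function. Hence \<open>vanishing\<close>
  suffices to recover the topology of \<open>X\<close>.\<close>

lemma vanishing_separates:
  assumes "Z \<in> E_set P X" "openin X U" "x \<in> U"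
  shows "\<exists>g\<in>vanishing. g x = 1 \<and> (\<forall>y. y \<notin> U \<longrightarrow> g y = 0)"
proof -
  note Zp = E_set_D[OF assms(1)]
  have "openin Z U"
    using openin_E_set assms by blast
  then obtain f where f: "continuous_map Z euclideanreal f" "f x = 1" "f ` (topspace Z - U) \<subseteq> {0}"
    using Zp(2) assms(3) unfolding completely_regular_space_gen_alt'[of 1 0, simplified] by blast
  have UX: "U \<subseteq> topspace X"
    using assms(2) openin_subset by blast
  show ?thesis
  proof (rule bexI)
    show "(\<lambda>x. if x \<in> topspace X then f x else 0) \<in> vanishing"
      using f UX by (intro vanishing_on_remainder[OF assms(1)]) (auto simp: remainder_def)
  qed (use f UX assms(3) Zp(5) in auto)
qed

end

subsection \<open>The reduced extension\<close>

text \<open>On the remainder \<open>h n\<close> is the indicator of the isolated point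
  \<open>q n\<close>; on \<open>X\<close> it is an arbitrary continuous function.\<close>

locale reduced_extension = small_sets +
  fixes Y :: "'a topology" and q :: "nat \<Rightarrow> 'a" and h :: "nat \<Rightarrow> 'a \<Rightarrow> real"
  assumes minimal: "minimal_extension P X Y"
    and inj_q: "inj q"
    and q_remainder: "q n \<in> remainder X Y"
    and continuous_h: "continuous_map Y euclideanreal (h n)"
    and h_self: "h n (q n) = 1"
    and h_remainder: "y \<in> remainder X Y \<Longrightarrow> y \<noteq> q n \<Longrightarrow> h n y = 0"
begin

section \<open>Isolated points of the remainder of \<open>Y\<close>\<close>

lemma Y_E_set: "Y \<in> E_set P X"
  using minimal by (simp add: minimal_extension_def)

lemmas Y_simps = E_set_D[OF Y_E_set]

lemma q_notin_X [simp]: "q n \<notin> topspace X"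
  using q_remainder[of n] by (simp add: remainder_def)

lemma q_eq_iff [simp]: "q m = q n \<longleftrightarrow> m = n"
  using inj_q by (simp add: inj_eq)

lemma h_q: "h m (q n) = (if n = m then 1 else 0)"
  using h_self h_remainder[OF q_remainder] by auto

text \<open>Otherwise \<open>q n\<close> could be dropped from \<open>Y\<close>.\<close>

lemma neighbourhood_not_small:
  assumes V: "openin Y V" "q n \<in> V"
  shows "\<not> small (V \<inter> topspace X)"
proof
  assume s: "small (V \<inter> topspace X)"
  define K' where "K' = remainder X Y - {q n}"
  define S where "S = topspace Y - {q n}"
  define Z where "Z = subtopology Y S"
  \<comment> \<open>Since \<open>h n\<close> isolates \<open>q n\<close>, the rest of the remainder
    is cut out by a closed condition and stays compact.\<close>
  have K'_eq: "K' = remainder X Y \<inter> {y \<in> topspace Y. h n y \<in> {..1/2}}"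
    using h_remainder h_self by (force simp: K'_def remainder_def)
  have K'c: "compactin Y K'"
    unfolding K'_eq using Y_simps(6) continuous_h
    by (intro compact_Int_closedin closedin_continuous_map_preimage[where Y = euclideanreal]) auto
  then have "closedin Y K'"
    using Y_simps(1) compactin_imp_closedin by blast
  then have "openin Y (V \<inter> (topspace Y - K'))"
    using V(1) by blast
  moreover have qV: "q n \<in> V \<inter> (topspace Y - K')"
    using V q_remainder[of n] by (auto simp: K'_def remainder_def)
  ultimately obtain f where f: "continuous_map Y euclideanreal f" "f (q n) = 1"
    "f ` (topspace Y - (V \<inter> (topspace Y - K'))) \<subseteq> {0}"
    using Y_simps(2) unfolding completely_regular_space_gen_alt'[of 1 0, simplified] by blast
  have SY: "S \<subseteq> topspace Y" and XS: "topspace X \<subseteq> S"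
    using Y_simps(5) by (auto simp: S_def)
  have tZ: "topspace Z = S"
    using SY by (auto simp: Z_def)
  have ZX: "subtopology Z (topspace X) = X"
    using XS Y_simps(4) by (simp add: Z_def subtopology_subtopology inf_absorb2)
  have rem: "remainder X Z = K'"
    unfolding K'_def remainder_def tZ S_def by auto
  have fZ: "continuous_map Z euclideanreal f"
    unfolding Z_def using f(1) by (rule continuous_map_from_subtopology)
  \<comment> \<open>\<open>A\<close> and \<open>B\<close> will cover \<open>Z\<close>:
    \<open>A\<close> is closed in \<open>Y\<close> and avoids \<open>q n\<close>, where
    \<open>f\<close> is 1, while \<open>B\<close> lies in the small set
    \<open>V \<inter> topspace X\<close>.\<close>
  define A where "A = {y \<in> topspace Y. f y \<in> {..1/2}}"
  define B where "B = {y \<in> topspace Z. f y \<in> {1/2..}}"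
  have AY: "closedin Y A"
    unfolding A_def using f(1) by (rule closedin_continuous_map_preimage) auto
  have AS: "A \<subseteq> S"
    using f(2) by (auto simp: A_def S_def)
  have "P (subtopology Y A)"
    using P_closed[OF Y_simps(1,3) AY] .
  moreover have "subtopology Z A = subtopology Y A"
    using AS by (simp add: Z_def subtopology_subtopology inf_absorb2)
  ultimately have PA: "P (subtopology Z A)"
    by simp
  have AZ: "closedin Z A"
    unfolding Z_def using AY AS by (rule closedin_subset_topspace)
  have BZ: "closedin Z B"
    unfolding B_def using fZ by (rule closedin_continuous_map_preimage) auto
  have BV: "B \<subseteq> V \<inter> topspace X"
  proof
    fix y assume "y \<in> B"
    then have y: "y \<in> topspace Y" "y \<noteq> q n" "f y \<ge> 1/2"
      unfolding B_def tZ S_def by auto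
    then have "f y \<noteq> 0" by auto
    then have "y \<in> V \<inter> (topspace Y - K')"
      using f(3) y(1) by blast
    then show "y \<in> V \<inter> topspace X"
      using y(2) Y_simps(9) by (auto simp: K'_def)
  qed
  have "closedin (subtopology Z (topspace X)) B"
    using BZ BV by (intro closedin_subset_topspace) auto
  then have "P (subtopology X B)"
    unfolding ZX using small_closed small_mono[OF s BV] by blast
  moreover have "subtopology Z B = subtopology X B"
    using ZX BV by (metis inf_absorb2 le_inf_iff subtopology_subtopology)
  ultimately have PB: "P (subtopology Z B)"
    by simp
  have HZ: "Hausdorff_space Z"
    unfolding Z_def by (rule Hausdorff_space_subtopology[OF Y_simps(1)])
  have "A \<union> B = topspace Z"
    using AS SY unfolding tZ by (auto simp: A_def B_def tZ)
  then have PZ: "P Z"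
    using closed_Un[OF infinite_UNIV P HZ AZ BZ PA PB] by simp
  have "Y closure_of topspace X = topspace Y"
    using Y_E_set by (simp add: E_set_def P_extension_def extension_of_def)
  then have "Z closure_of topspace X = topspace Z"
    using XS SY unfolding tZ by (simp add: Z_def closure_of_subtopology inf_absorb2 inf_absorb1)
  then have "extension_of X Z"
    using XS ZX tZ by (simp add: extension_of_def)
  moreover have "compact_remainder X Z"
    unfolding compact_remainder_def rem unfolding Z_def
    using K'c by (auto simp: compactin_subtopology K'_def S_def remainder_def)
  moreover have "tychonoff_space Z"
    using HZ completely_regular_space_subtopology[OF Y_simps(2)] by (simp add: tychonoff_space_def Z_def)
  ultimately have "Z \<in> E_set P X"
    using PZ by (simp add: E_set_def P_extension_def)
  moreover have "proper_subspace Z Y"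
    using q_remainder[of n] unfolding proper_subspace_def tZ unfolding Z_def S_def
    by (auto simp: remainder_def)
  ultimately show False
    using minimal by (auto simp: minimal_extension_def)
qed

text \<open>
  The point \<open>q 0\<close> absorbs all points of the remainder of \<open>Y\<close> except \<open>q 1\<close>, \<open>q 2\<close> and so on; the
  functions in \<^const>\<open>vanishing\<close> make the topology as fine as possible.
\<close>

definition W :: "'a topology" where
  "W = initial_topology (topspace X \<union> range q) (vanishing \<union> h ` {1..})"

definition collapse :: "'a \<Rightarrow> 'a" where
  "collapse p = (if p \<in> q ` {1..} then p else q 0)"

section \<open>The topology of \<open>W\<close>\<close>

lemma topspace_W [simp]: "topspace W = topspace X \<union> range q"
  by (simp add: W_def)

lemma remainder_W: "remainder X W = range q"
  by (auto simp: remainder_def)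

lemma continuous_vanishing: "g \<in> vanishing \<Longrightarrow> continuous_map W euclideanreal g"
  unfolding W_def by (rule continuous_map_initial_topology) simp

lemma continuous_h_W: "n \<ge> 1 \<Longrightarrow> continuous_map W euclideanreal (h n)"
  unfolding W_def by (rule continuous_map_initial_topology) simp

lemma vanishing_q: "g \<in> vanishing \<Longrightarrow> g (q n) = 0"
  by (simp add: vanishing_def)

text \<open>Functions in \<open>vanishing\<close> give back every open set of \<open>X\<close>;
  conversely all generators are continuous on \<open>X\<close>, so no new open sets arise
  there.\<close>

lemma openin_W_iff_X:
  assumes "U \<subseteq> topspace X"
  shows "openin W U \<longleftrightarrow> openin X U"
proof
  assume U: "openin X U"
  have "\<exists>T. openin W T \<and> x \<in> T \<and> T \<subseteq> U" if x: "x \<in> U" for x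
  proof -
    obtain g where g: "g \<in> vanishing" "g x = 1" "\<forall>y. y \<notin> U \<longrightarrow> g y = 0"
      using vanishing_separates[OF Y_E_set U x] by blast
    have "openin W {y \<in> topspace W. g y \<in> {0<..}}"
      using continuous_vanishing[OF g(1)] by (rule openin_continuous_map_preimage) auto
    moreover have "{y \<in> topspace W. g y \<in> {0<..}} \<subseteq> U"
      using g(3) by force
    ultimately show ?thesis
      using x g(2) assms by (intro exI[of _ "{y \<in> topspace W. g y \<in> {0<..}}"]) auto
  qed
  then show "openin W U"
    using openin_subopen[of W U] by blast
next
  have *: "openin X (U \<inter> topspace X)" if "openin W U" for U
    using that unfolding W_def
  proof (induction rule: openin_initial_topology_induct)
    case space
    then show ?case by (simp add: inf_absorb2)
  next
    case (preimage f U)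
    have "continuous_map X euclideanreal f"
    proof (cases "f \<in> vanishing")
      case True
      then show ?thesis by (simp add: vanishing_def)
    next
      case False
      then obtain n where "f = h n" using preimage by blast
      then show ?thesis
        using continuous_map_from_subtopology[OF continuous_h, of "topspace X"] Y_simps(4) by simp
    qed
    then have "openin X {x \<in> topspace X. f x \<in> U}"
      using preimage(2) by (intro openin_continuous_map_preimage) auto
    moreover have "{y \<in> topspace X \<union> range q. f y \<in> U} \<inter> topspace X = {x \<in> topspace X. f x \<in> U}"
      by auto
    ultimately show ?case by simp
  next
    case (Int A B)
    have "A \<inter> B \<inter> topspace X = (A \<inter> topspace X) \<inter> (B \<inter> topspace X)" by auto
    then show ?case using Int by (simp add: openin_Int)
  next
    case (Union \<U>)
    have "\<Union>\<U> \<inter> topspace X = (\<Union>A\<in>\<U>. A \<inter> topspace X)" by auto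
    then show ?case using Union by (metis (no_types, lifting) imageE openin_Union)
  qed
  assume "openin W U"
  then show "openin X U"
    using *[of U] assms by (simp add: inf_absorb1)
qed

lemma openin_X_W: "openin W (topspace X)"
  by (simp add: openin_W_iff_X)

lemma subtopology_W: "subtopology W (topspace X) = X"
proof -
  have "openin (subtopology W (topspace X)) U \<longleftrightarrow> openin X U" for U
    using openin_open_subtopology[OF openin_X_W, of U] openin_W_iff_X[of U] openin_subset[of X U] by blast
  then show ?thesis by (simp add: topology_eq)
qed

lemma tychonoff_W: "tychonoff_space W"
  unfolding tychonoff_space_def
proof
  show "completely_regular_space W"
    unfolding W_def by (rule completely_regular_initial_topology)
  have *: "\<exists>f\<in>vanishing. f x \<noteq> f y" if "x \<in> topspace X" "x \<noteq> y" for x y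
  proof -
    have "openin X (topspace X - {y})"
      using closedin_Hausdorff_singleton[OF Hausdorff_X, of y]
      by (cases "y \<in> topspace X") (simp_all add: openin_diff)
    then have "\<exists>g\<in>vanishing. g x = 1 \<and> (\<forall>z. z \<notin> topspace X - {y} \<longrightarrow> g z = 0)"
      by (rule vanishing_separates[OF Y_E_set]) (use that in simp)
    then show ?thesis by (metis Diff_iff insertI1 zero_neq_one)
  qed
  show "Hausdorff_space W"
    unfolding W_def
  proof (rule Hausdorff_initial_topology)
    fix x y assume xy: "x \<in> topspace X \<union> range q" "y \<in> topspace X \<union> range q" "x \<noteq> y"
    consider "x \<in> topspace X" | "y \<in> topspace X" | m n where "x = q m" "y = q n"
      using xy by blast
    then show "\<exists>f\<in>vanishing \<union> h ` {1..}. f x \<noteq> f y"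
    proof cases
      case 1
      then show ?thesis using *[of x y] xy by blast
    next
      case 2
      then show ?thesis using *[of y x] xy by (metis UnI1)
    next
      case 3
      then have "h (max m n) x \<noteq> h (max m n) y" "max m n \<ge> 1"
        using xy(3) by (auto simp: h_q max_def)
      then show ?thesis by auto
    qed
  qed
qed

lemma collapse_q [simp]: "collapse (q n) = q n"
  by (cases n) (auto simp: collapse_def)

lemma collapse_range: "collapse p \<in> range q"
  by (auto simp: collapse_def)

text \<open>
  Up to small sets, the neighbourhoods in \<open>W\<close> are the images of those in the quotient of \<open>Y\<close>
  under \<^const>\<open>collapse\<close>.
\<close>

lemma openin_W_neighbourhood:
  assumes "openin W U" "p \<in> remainder X Y" "collapse p \<in> U"
  shows "\<exists>V. openin Y V \<and> p \<in> V \<and> small (V \<inter> topspace X - U)"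
  using assms(1,3) unfolding W_def
proof (induction rule: openin_initial_topology_induct)
  case space
  show ?case
    using assms(2) by (intro exI[of _ "topspace Y"]) (auto simp: remainder_def intro: small_mono[OF small_empty])
next
  case (preimage f U)
  show ?case
  proof (cases "f \<in> vanishing")
    case True
    \<comment> \<open>A vanishing function is 0 at every \<open>q n\<close>, so this generator
      excludes only a small part of \<open>X\<close> and \<open>V\<close> can be all of
      \<open>Y\<close>.\<close>
    have "f (collapse p) = 0"
      using vanishing_q[OF True] collapse_range[of p] by auto
    then have "0 \<in> U" using preimage by simp
    then obtain e where e: "e > 0" "ball 0 e \<subseteq> U"
      using preimage(2) openE by blast
    have "small {x \<in> topspace X. e \<le> \<bar>f x\<bar>}"
      using True e by (simp add: vanishing_def)
    then have "small (topspace Y \<inter> topspace X - {y \<in> topspace X \<union> range q. f y \<in> U})"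
    proof (rule small_mono)
      show "topspace Y \<inter> topspace X - {y \<in> topspace X \<union> range q. f y \<in> U} \<subseteq> {x \<in> topspace X. e \<le> \<bar>f x\<bar>}"
        using e(2) by (force simp: subset_iff)
    qed
    then show ?thesis
      using assms(2) by (intro exI[of _ "topspace Y"]) (auto simp: remainder_def)
  next
    case False
    then obtain n where n: "f = h n" "n \<ge> 1" using preimage by auto
    let ?V = "{y \<in> topspace Y. f y \<in> U}"
    have "openin Y ?V"
      using continuous_h[of n] preimage(2) unfolding n by (intro openin_continuous_map_preimage) auto
    \<comment> \<open>As \<open>n \<ge> 1\<close>, \<open>h n\<close> is 0 at \<open>q 0\<close> and
      at every remainder point sent there, so on the remainder it factors through
      \<open>collapse\<close>.\<close>
    moreover have "f (collapse p) = f p"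
    proof (cases "p \<in> q ` {1..}")
      case True
      then show ?thesis by (simp add: collapse_def)
    next
      case False
      then have "p \<noteq> q n" using n(2) by auto
      then have "f p = 0" using h_remainder[OF assms(2)] n by simp
      then show ?thesis using False n(2) h_q[of n 0] by (auto simp: collapse_def n)
    qed
    then have "p \<in> ?V"
      using preimage assms(2) by (simp add: remainder_def)
    moreover have "?V \<inter> topspace X - {y \<in> topspace X \<union> range q. f y \<in> U} = {}"
      by auto
    ultimately show ?thesis
      using small_empty by metis
  qed
next
  case (Int A B)
  then obtain V V' where V: "openin Y V" "p \<in> V" "small (V \<inter> topspace X - A)"
    "openin Y V'" "p \<in> V'" "small (V' \<inter> topspace X - B)"
    by auto
  have "small ((V \<inter> V') \<inter> topspace X - A \<inter> B)"
    by (rule small_mono[OF small_Un[OF V(3,6)]]) auto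
  then show ?case
    using V by (intro exI[of _ "V \<inter> V'"]) auto
next
  case (Union \<U>)
  then obtain A where A: "A \<in> \<U>" "collapse p \<in> A" by blast
  then obtain V where V: "openin Y V" "p \<in> V" "small (V \<inter> topspace X - A)"
    using Union by blast
  have "small (V \<inter> topspace X - \<Union>\<U>)"
    using A(1) by (intro small_mono[OF V(3)]) auto
  then show ?case using V by blast
qed

text \<open>Among the generating functions, those in \<open>vanishing\<close> are 0 at every
  \<open>q n\<close>, and an \<open>h n\<close> with \<open>n \<ge> 1\<close> tells only
  \<open>q n\<close> apart from \<open>q 0\<close>. So the sequence \<open>q\<close> converges to
  \<open>q 0\<close>.\<close>

lemma finite_outside_neighbourhood:
  assumes "openin W U" "q 0 \<in> U"
  shows "finite {n. q n \<notin> U}"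
  using assms unfolding W_def
proof (induction rule: openin_initial_topology_induct)
  case space
  show ?case by simp
next
  case (preimage f U)
  show ?case
  proof (cases "f \<in> vanishing")
    case True
    then show ?thesis using preimage by (simp add: vanishing_q)
  next
    case False
    then obtain n where n: "f = h n" "n \<ge> 1" using preimage by auto
    have "0 \<in> U"
      using preimage(3) n by (simp add: h_q split: if_splits)
    then have "{m. q m \<notin> {y \<in> topspace X \<union> range q. f y \<in> U}} \<subseteq> {n}"
      using n by (auto simp: h_q split: if_splits)
    then show ?thesis using finite_subset by blast
  qed
next
  case (Int A B)
  have "{n. q n \<notin> A \<inter> B} = {n. q n \<notin> A} \<union> {n. q n \<notin> B}" by auto
  then show ?case using Int by simp
next
  case (Union \<U>)
  then obtain A where A: "A \<in> \<U>" "q 0 \<in> A" by blast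
  then have "finite {n. q n \<notin> A}" using Union by blast
  then show ?case by (rule finite_subset[rotated]) (use A in auto)
qed

section \<open>\<open>W\<close> as an extension with compact remainder\<close>

text \<open>A neighbourhood of \<open>q n\<close> missing \<open>X\<close> would, by
  \<open>openin_W_neighbourhood\<close>, make the trace on \<open>X\<close> of a neighbourhood in
  \<open>Y\<close> small, against \<open>neighbourhood_not_small\<close>.\<close>

lemma closure_of_X: "W closure_of topspace X = topspace W"
proof -
  have *: "\<exists>y. y \<in> topspace X \<and> y \<in> U" if U: "openin W U" "q n \<in> U" for n U
  proof (rule ccontr)
    assume "\<not> ?thesis"
    then have e: "V \<inter> topspace X - U = V \<inter> topspace X" for V
      by blast
    obtain V where "openin Y V" "q n \<in> V" "small (V \<inter> topspace X - U)"
      using openin_W_neighbourhood[OF U(1) q_remainder[of n]] U(2) by auto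
    then show False
      using neighbourhood_not_small e by simp
  qed
  have "q n \<in> W closure_of topspace X" for n
    unfolding in_closure_of by (intro conjI allI impI *) auto
  moreover have "topspace X \<subseteq> W closure_of topspace X"
    by (intro closure_of_subset) simp
  ultimately have "topspace W \<subseteq> W closure_of topspace X"
    by auto
  then show ?thesis
    using closure_of_subset_topspace by (metis subset_antisym)
qed

lemma extension_W: "extension_of X W"
  by (simp add: extension_of_def subtopology_W closure_of_X del: topspace_W) simp

text \<open>A member of the cover that contains \<open>q 0\<close> misses only finitely many
  points.\<close>

lemma compact_remainder_W: "compact_remainder X W"
  unfolding compact_remainder_def remainder_W compactin_def
proof (intro conjI allI impI)
  fix \<U> assume \<U>: "Ball \<U> (openin W) \<and> range q \<subseteq> \<Union>\<U>"
  then have "\<forall>n. \<exists>U\<in>\<U>. q n \<in> U" by blast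
  then obtain U where U: "\<And>n. U n \<in> \<U>" "\<And>n. q n \<in> U n" by metis
  let ?I = "{n. q n \<notin> U 0}"
  have "finite ?I"
    using finite_outside_neighbourhood U \<U> by blast
  moreover have "range q \<subseteq> \<Union>(insert (U 0) (U ` ?I))"
    using U(2) by auto
  ultimately show "\<exists>\<F>. finite \<F> \<and> \<F> \<subseteq> \<U> \<and> range q \<subseteq> \<Union>\<F>"
    using U(1) by (intro exI[of _ "insert (U 0) (U ` ?I)"]) auto
qed simp

section \<open>Condition (W) applied to \<open>W\<close>\<close>

text \<open>Each remainder point \<open>p\<close> of \<open>Y\<close> has a neighbourhood meeting
  \<open>E\<close> in a small set, as \<open>collapse p\<close> is not in \<open>E\<close>. Finitely
  many of these cover the compact remainder; what they leave of \<open>Y\<close> is closed in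
  \<open>Y\<close> and contained in \<open>X\<close>, hence small.\<close>

lemma closedin_W_small:
  assumes "closedin W E" "E \<subseteq> topspace X"
  shows "small E"
proof -
  let ?U = "topspace W - E"
  have "\<exists>V. openin Y V \<and> p \<in> V \<and> small (V \<inter> E)" if p: "p \<in> remainder X Y" for p
  proof -
    have "collapse p \<in> ?U"
      using collapse_range[of p] assms(2) by auto
    moreover have "V \<inter> topspace X - ?U = V \<inter> E" for V
      using assms(2) by auto
    ultimately show ?thesis
      using openin_W_neighbourhood[of ?U p] assms(1) p by (metis openin_diff openin_topspace)
  qed
  then obtain V where V: "\<And>p. p \<in> remainder X Y \<Longrightarrow> openin Y (V p) \<and> p \<in> V p \<and> small (V p \<inter> E)"
    by metis
  have "\<forall>B\<in>V ` remainder X Y. openin Y B" "remainder X Y \<subseteq> \<Union>(V ` remainder X Y)"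
    using V by blast+
  then obtain \<F> where "finite \<F>" "\<F> \<subseteq> V ` remainder X Y" "remainder X Y \<subseteq> \<Union>\<F>"
    using compactinD[OF Y_simps(6), of "V ` remainder X Y"] by metis
  then obtain I where I: "finite I" "I \<subseteq> remainder X Y" "remainder X Y \<subseteq> (\<Union>p\<in>I. V p)"
    by (metis finite_subset_image)
  let ?D = "topspace Y - (\<Union>p\<in>I. V p)"
  have "closedin Y ?D"
    using I(2) V by (intro closedin_diff openin_Union) auto
  moreover have "?D \<subseteq> topspace X"
    using I(3) Y_simps(9) by blast
  ultimately have "small ?D"
    using small_closedin_extension[OF Y_simps(1,3,4)] by blast
  moreover have "small (\<Union>p\<in>I. V p \<inter> E)"
    using I V by (intro small_UN) auto
  ultimately have "small (?D \<union> (\<Union>p\<in>I. V p \<inter> E))"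
    by (rule small_Un)
  then show ?thesis
    by (rule small_mono) (use assms(2) Y_simps(5) in auto)
qed

text \<open>The property \<open>R\<close> is arbitrary because the lemma serves both
  \<open>P\<close> and \<open>Q\<close>. Condition (W) is applied at one remainder point at a time,
  and finally at the limit \<open>q 0\<close>.\<close>

lemma mrowka_W_property:
  assumes R: "mrowka_W R"
    and E: "\<And>E. closedin W E \<Longrightarrow> E \<subseteq> topspace X \<Longrightarrow> R (subtopology W E)"
  shows "R W"
proof -
  \<comment> \<open>Induction on the remainder points that \<open>E\<close> may contain: removing a
    neighbourhood of \<open>q n\<close> leaves a closed set without \<open>q n\<close>.\<close>
  have *: "R (subtopology W E)" if "finite N" "closedin W E" "E \<inter> range q \<subseteq> q ` N" for N E
    using that
  proof (induction N arbitrary: E rule: finite_induct)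
    case empty
    then have "E \<subseteq> topspace X"
      using closedin_subset[of W E] by auto
    then show ?case using E empty by blast
  next
    case (insert n N)
    show ?case
    proof (cases "q n \<in> E")
      case False
      then have "E \<inter> range q \<subseteq> q ` N" using insert.prems(2) by auto
      then show ?thesis using insert by blast
    next
      case True
      let ?T = "subtopology W E"
      let ?B = "{B. openin ?T B \<and> q n \<in> B}"
      have tE: "topspace ?T = E"
        using closedin_subset[OF insert.prems(1)] by auto
      have "tychonoff_space ?T"
        using tychonoff_W by (simp add: tychonoff_space_def Hausdorff_space_subtopology
            completely_regular_space_subtopology)
      moreover have "open_base_at ?T (q n) ?B"
        by (auto simp: open_base_at_def)
      moreover have "R (subtopology ?T (topspace ?T - B))" if B: "B \<in> ?B" for B
      proof -
        have "closedin ?T (E - B)"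
          using B openin_topspace[of ?T] tE by (metis closedin_def closedin_diff closedin_topspace mem_Collect_eq)
        then have "closedin W (E - B)"
          using insert.prems(1) closedin_trans_full by blast
        moreover have "(E - B) \<inter> range q \<subseteq> q ` N"
          using B insert.prems(2) by auto
        ultimately have "R (subtopology W (E - B))"
          using insert.IH by blast
        then show ?thesis
          by (simp only: tE subtopology_subtopology) (simp add: Int_Diff inf_absorb2)
      qed
      ultimately show ?thesis
        using R True tE unfolding mrowka_W_def by blast
    qed
  qed
  \<comment> \<open>The complement of a neighbourhood of \<open>q 0\<close> contains finitely many
    \<open>q n\<close>, so the claim just proved covers it.\<close>
  let ?B = "{B. openin W B \<and> q 0 \<in> B}"
  have "open_base_at W (q 0) ?B"
    by (auto simp: open_base_at_def)
  moreover have "R (subtopology W (topspace W - B))" if B: "B \<in> ?B" for B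
  proof (rule *)
    show "finite {n. q n \<notin> B}"
      using B finite_outside_neighbourhood by blast
    show "closedin W (topspace W - B)"
      using B by blast
  qed auto
  moreover have "q 0 \<in> topspace W" by simp
  ultimately show ?thesis
    using R tychonoff_W unfolding mrowka_W_def by blast
qed

lemma subtopology_W_closed:
  assumes "closedin W E" "E \<subseteq> topspace X"
  shows "closedin X E" "subtopology W E = subtopology X E"
proof -
  show "closedin X E"
    using closedin_subset_topspace[OF assms] by (simp add: subtopology_W)
  show "subtopology W E = subtopology X E"
    using subtopology_W assms(2) by (metis inf_absorb2 subtopology_subtopology)
qed

lemma P_W: "P W"
proof (rule mrowka_W_property)
  show "mrowka_W P"
    using P by (simp add: compactness_like_def)
  fix E assume "closedin W E" "E \<subseteq> topspace X"
  then show "P (subtopology W E)"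
    using subtopology_W_closed closedin_W_small small_closed by metis
qed

lemma W_E_set: "W \<in> E_set P X"
  by (simp add: E_set_def P_extension_def extension_W P_W tychonoff_W compact_remainder_W)

section \<open>Tightness and minimality\<close>

text \<open>A smaller extension \<open>Z\<close> omits some \<open>q n\<close>. Adjoining
  \<open>q n\<close> to \<open>C\<close> gives a closed set of \<open>W\<close>, so \<open>C\<close>
  is closed in \<open>Z\<close> and therefore small; yet \<open>C\<close> contains the trace on
  \<open>X\<close> of a neighbourhood of \<open>q n\<close> in \<open>Y\<close>.\<close>

lemma tight_W: "tight_extension P X W"
  unfolding tight_extension_def
proof (intro conjI notI)
  show "P_extension P X W" "tychonoff_space W"
    by (simp_all add: P_extension_def extension_W P_W tychonoff_W)
  assume "\<exists>Z. P_extension P X Z \<and> proper_subspace Z W"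
  then obtain Z where Z: "extension_of X Z" "P Z" "topspace Z \<subset> topspace W" "Z = subtopology W (topspace Z)"
    by (auto simp: P_extension_def proper_subspace_def)
  then have XZ: "topspace X \<subseteq> topspace Z" "subtopology Z (topspace X) = X"
    by (auto simp: extension_of_def)
  then obtain n where n: "q n \<notin> topspace Z"
    using Z(3) by auto
  define C where "C = {x \<in> topspace X. 1/2 \<le> h n x}"
  have "\<exists>U. openin W U \<and> y \<in> U \<and> U \<subseteq> topspace W - C - {q n}" if y: "y \<in> topspace W - C - {q n}" for y
  proof -
    consider "y \<in> topspace X" | m where "y = q m" "m \<noteq> n" "m \<ge> 1" | "y = q 0" "n \<ge> 1"
    proof -
      consider "y \<in> topspace X" | m where "y = q m" "m \<noteq> n"
        using y by auto
      then show thesis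
        using that by cases (use less_one linorder_not_less in metis)+
    qed
    then show ?thesis
    proof cases
      case 1
      have "continuous_map X euclideanreal (h n)"
        using continuous_map_from_subtopology[OF continuous_h, of "topspace X"] Y_simps(4) by simp
      then have "openin X {x \<in> topspace X. h n x \<in> {..<1/2}}"
        by (rule openin_continuous_map_preimage) auto
      then have "openin W {x \<in> topspace X. h n x \<in> {..<1/2}}"
        by (subst openin_W_iff_X) auto
      then show ?thesis
        using 1 y by (intro exI[of _ "{x \<in> topspace X. h n x \<in> {..<1/2}}"]) (auto simp: C_def)
    next
      case (2 m)
      \<comment> \<open>Here \<open>n\<close> may be 0, so \<open>h n\<close> need not be continuous
        on \<open>W\<close>. Its minimum with \<open>h m\<close> vanishes on the remainder and hence
        yields a generator; on \<open>X\<close>, \<open>h m > 1/2\<close> and \<open>g < 1/2\<close>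
        force \<open>h n < 1/2\<close>.\<close>
      define g where "g = (\<lambda>x. if x \<in> topspace X then min (h m x) (h n x) else 0)"
      have g: "g \<in> vanishing"
        unfolding g_def
      proof (rule vanishing_on_remainder[OF Y_E_set])
        fix y assume y: "y \<in> remainder X Y"
        have "h m y = 0 \<or> h n y = 0"
          using h_remainder[OF y] 2(2) by (metis q_eq_iff)
        moreover have "h k y \<ge> 0" for k
          using h_remainder[OF y, of k] h_self[of k] by (cases "y = q k") auto
        ultimately show "min (h m y) (h n y) = 0"
          by (metis min.absorb1 min.absorb2)
      qed (intro continuous_map_real_min continuous_h)
      let ?U = "{x \<in> topspace W. h m x \<in> {1/2<..}} \<inter> {x \<in> topspace W. g x \<in> {..<1/2}}"
      have "openin W ?U"
        by (intro openin_Int openin_continuous_map_preimage[OF continuous_h_W[OF 2(3)]]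
            openin_continuous_map_preimage[OF continuous_vanishing[OF g]]) auto
      moreover have "?U \<subseteq> topspace W - C - {q n}"
        using 2(2) by (auto simp: C_def g_def h_q)
      moreover have "y \<in> ?U"
        using 2 by (simp add: h_self vanishing_q[OF g])
      ultimately show ?thesis by blast
    next
      case 3
      let ?U = "{x \<in> topspace W. h n x \<in> {..<1/2}}"
      have "openin W ?U"
        using continuous_h_W[OF 3(2)] by (rule openin_continuous_map_preimage) auto
      moreover have "?U \<subseteq> topspace W - C - {q n}"
        by (auto simp: C_def h_q)
      moreover have "y \<in> ?U"
        using 3 by (simp add: h_q)
      ultimately show ?thesis by blast
    qed
  qed
  then have "openin W (topspace W - C - {q n})"
    using openin_subopen[of W "topspace W - C - {q n}"] by blast
  then have "openin (subtopology W (topspace Z)) (topspace Z \<inter> (topspace W - C - {q n}))"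
    by (rule openin_subtopology_Int2)
  moreover have "topspace Z \<inter> (topspace W - C - {q n}) = topspace Z - C"
    using n Z(3) by blast
  ultimately have "openin Z (topspace Z - C)"
    using Z(4) by simp
  then have "closedin Z C"
    using XZ(1) by (auto simp: closedin_def C_def)
  moreover have "Hausdorff_space Z"
    using Z(4) tychonoff_W Hausdorff_space_subtopology[of W "topspace Z"] by (simp add: tychonoff_space_def)
  moreover have "C \<subseteq> topspace X"
    by (auto simp: C_def)
  ultimately have sC: "small C"
    using small_closedin_extension Z(2) XZ(2) by blast
  let ?V = "{x \<in> topspace Y. h n x \<in> {1/2<..}}"
  have "openin Y ?V"
    using continuous_h by (rule openin_continuous_map_preimage) auto
  moreover have "q n \<in> ?V"
    using q_remainder[of n] by (simp add: h_self remainder_def)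
  moreover have "small (?V \<inter> topspace X)"
    by (rule small_mono[OF sC]) (auto simp: C_def)
  ultimately show False
    using neighbourhood_not_small by blast
qed

lemma minimal_W: "minimal_extension P X W"
  using tight_W W_E_set by (auto simp: minimal_extension_def tight_extension_def E_set_def)

section \<open>Optimality\<close>

text \<open>A function \<open>l\<close> continuous on \<open>W\<close> selects the remainder points
  allowed near \<open>q n\<close>; shrinking into \<open>U\<close> inside \<open>X\<close> is done
  by a function that vanishes on the remainder of \<open>Z\<close>. Such a function is already a
  generator of \<open>W\<close>.\<close>

lemma finer_openin_W:
  assumes Z: "Z \<in> E_set P X" "topspace Z = topspace W"
    and finer: "\<And>U. openin W U \<Longrightarrow> openin Z U"
    and U: "openin Z U" "q n \<in> U"
  shows "\<exists>T. openin W T \<and> q n \<in> T \<and> T \<subseteq> U"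
proof -
  note Zp = E_set_D[OF Z(1)]
  have rem: "remainder X Z = range q"
    using Z(2) by (auto simp: remainder_def)
  have cont: "continuous_map Z euclideanreal f" if "continuous_map W euclideanreal f" for f
    using that finer Z(2) by (simp add: continuous_map_def)
  \<comment> \<open>For \<open>n > 0\<close>, \<open>1 - h n\<close> selects \<open>q n\<close>
    alone. For \<open>n = 0\<close> a sum of functions \<open>h m\<close> rejects the points outside
    \<open>U\<close>, which requires these to be finitely many.\<close>
  obtain l where l: "continuous_map W euclideanreal l" "\<And>m. l (q m) = 0 \<or> l (q m) = 1"
    "l (q n) = 0" "\<And>m. l (q m) = 0 \<Longrightarrow> q m \<in> U"
  proof (cases "n = 0")
    case False
    then have "continuous_map W euclideanreal (\<lambda>y. 1 - h n y)"
      by (intro continuous_map_diff continuous_h_W) auto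
    then show thesis
      using U(2) by (intro that[of "\<lambda>y. 1 - h n y"]) (auto simp: h_q split: if_splits)
  next
    case True
    let ?D = "range q - U"
    have "closedin Z (topspace Z - U)"
      using U(1) by blast
    then have "compactin Z (range q \<inter> (topspace Z - U))"
      using Zp(6) unfolding rem by (rule compact_Int_closedin[rotated])
    moreover have "range q \<inter> (topspace Z - U) = ?D"
      using Z(2) by auto
    \<comment> \<open>Compactness passes to the coarser topology, where it makes \<open>?D\<close>
      closed. Its complement is then a neighbourhood of \<open>q 0\<close>, so \<open>?D\<close> is
      finite.\<close>
    ultimately have "compactin W ?D"
      using compactin_contractive[of Z ?D W] Z(2) finer by simp
    then have "closedin W ?D"
      using tychonoff_W compactin_imp_closedin unfolding tychonoff_space_def by blast
    then have "openin W (topspace W - ?D)"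
      by blast
    moreover have "q 0 \<in> topspace W - ?D"
      using U(2) True by simp
    ultimately have "finite {m. q m \<notin> topspace W - ?D}"
      by (rule finite_outside_neighbourhood)
    moreover have "{m. q m \<notin> topspace W - ?D} = {m. q m \<notin> U}"
      by auto
    ultimately have fin: "finite {m. q m \<notin> U}"
      by simp
    let ?l = "\<lambda>y. \<Sum>m | q m \<notin> U. h m y"
    have lq: "?l (q m) = (if q m \<in> U then 0 else 1)" for m
      using fin by (simp add: h_q)
    have "continuous_map W euclideanreal ?l"
    proof (intro continuous_map_sum fin continuous_h_W)
      fix m assume "m \<in> {m. q m \<notin> U}"
      then show "m \<ge> 1" using U(2) True by (cases m) auto
    qed
    then show thesis
      using lq U(2) by (intro that[of ?l]) (auto split: if_splits)
  qed
  define S where "S = range q \<inter> {y \<in> topspace Z. l y \<in> {0}}"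
  have "compactin Z S"
    unfolding S_def using Zp(6) cont[OF l(1)] rem
    by (intro compact_Int_closedin closedin_continuous_map_preimage[where Y = euclideanreal]) auto
  moreover have "closedin Z (topspace Z - U)"
    using U(1) by blast
  moreover have "disjnt S (topspace Z - U)"
    using l(4) by (auto simp: S_def disjnt_def)
  ultimately obtain k where k: "continuous_map Z euclideanreal k" "k ` (topspace Z - U) \<subseteq> {1}" "k ` S \<subseteq> {0}"
    using Urysohn_completely_regular_compact_closed_alt[OF Zp(2)] by metis
  \<comment> \<open>On the remainder either \<open>l = 0\<close> and \<open>k = 0\<close>, or
    \<open>l = 1\<close> and the second argument is 0. On \<open>X\<close>, \<open>l < 1/4\<close>
    makes the second argument exceed \<open>1/4\<close>, so \<open>g < 1/4\<close> bounds
    \<open>k\<close> away from 1, its value off \<open>U\<close>.\<close>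
  define g where "g = (\<lambda>x. if x \<in> topspace X then min \<bar>k x\<bar> (max 0 (1/2 - l x)) else 0)"
  have g: "g \<in> vanishing"
    unfolding g_def
  proof (rule vanishing_on_remainder[OF Z(1)])
    show "continuous_map Z euclideanreal (\<lambda>x. min \<bar>k x\<bar> (max 0 (1/2 - l x)))"
      using k(1) cont[OF l(1)]
      by (intro continuous_map_real_min continuous_map_real_max continuous_map_real_abs continuous_map_diff) auto
    fix y assume "y \<in> remainder X Z"
    then obtain m where m: "y = q m" unfolding rem by blast
    show "min \<bar>k y\<bar> (max 0 (1/2 - l y)) = 0"
    proof (cases "l y = 0")
      case True
      then have "y \<in> S" using m Z(2) by (auto simp: S_def)
      then have "k y = 0" using k(3) by blast
      then show ?thesis by simp
    next
      case False
      then have "l y = 1" using l(2) m by blast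
      then show ?thesis by simp
    qed
  qed
  let ?T = "{y \<in> topspace W. l y \<in> {..<1/4}} \<inter> {y \<in> topspace W. g y \<in> {..<1/4}}"
  have "openin W ?T"
    by (intro openin_Int openin_continuous_map_preimage[OF l(1)]
        openin_continuous_map_preimage[OF continuous_vanishing[OF g]]) auto
  moreover have "q n \<in> ?T"
    using l(3) vanishing_q[OF g] by simp
  moreover have "?T \<subseteq> U"
  proof
    fix y assume y: "y \<in> ?T"
    show "y \<in> U"
    proof (cases "y \<in> topspace X")
      case True
      then have "min \<bar>k y\<bar> (max 0 (1/2 - l y)) < 1/4" "l y < 1/4"
        using y by (auto simp: g_def)
      then have "k y \<noteq> 1" by (auto simp: min_def max_def split: if_splits)
      then show ?thesis
        using k(2) y Z(2) by auto
    next
      case False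
      then obtain m where m: "y = q m" using y by auto
      then have "l y = 0" using y l(2)[of m] by auto
      then show ?thesis using l(4) m by simp
    qed
  qed
  ultimately show ?thesis by blast
qed

lemma optimal_W: "optimal_extension P X W"
  unfolding optimal_extension_def
proof (intro conjI ballI impI minimal_W)
  fix Z assume Z: "Z \<in> E_set P X" and "topspace Z = topspace W \<and> {U. openin W U} \<subseteq> {U. openin Z U}"
  then have tZ: "topspace Z = topspace W" and finer: "\<And>U. openin W U \<Longrightarrow> openin Z U"
    by auto
  have "openin W U" if U: "openin Z U" for U
  proof -
    have "\<exists>T. openin W T \<and> y \<in> T \<and> T \<subseteq> U" if y: "y \<in> U" for y
    proof (cases "y \<in> topspace X")
      case True
      have "openin (subtopology Z (topspace X)) (topspace X \<inter> U)"
        using U by (rule openin_subtopology_Int2)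
      then have "openin W (topspace X \<inter> U)"
        using E_set_D(4)[OF Z] by (simp add: openin_W_iff_X)
      then show ?thesis
        using True y by (intro exI[of _ "topspace X \<inter> U"]) auto
    next
      case False
      then obtain n where "y = q n"
        using y openin_subset[OF U] tZ by auto
      then show ?thesis
        using finer_openin_W[OF Z tZ finer U] y by blast
    qed
    then show ?thesis
      using openin_subopen[of W U] by blast
  qed
  then show "Z = W"
    unfolding topology_eq using finer by blast
qed

lemma countable_point_W: "countable_point X W"
  unfolding countable_point_def remainder_W using inj_q by (simp add: range_inj_infinite)

end

section \<open>The equivalence\<close>

text \<open>Minimality allows only competitors from \<open>E_set\<close>, all of which tightness
  excludes as well.\<close>

lemma tight_imp_minimal:
  assumes "tight_extension P X Y" "compact_remainder X Y"
  shows "minimal_extension P X Y"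
  using assms by (auto simp: tight_extension_def minimal_extension_def E_set_def)

lemma countable_point_minimal_imp_optimal_tight:
  fixes P Q :: "'a topology \<Rightarrow> bool"
  assumes PQ: "compactness_like_pair P Q" and X: "tychonoff_space X" "Q X"
    and Y: "minimal_extension P X Y" "countable_point X Y"
  shows "\<exists>W. optimal_extension P X W \<and> tight_extension P X W \<and> compact_remainder X W \<and>
    countable_point X W \<and> Q W"
proof -
  have K: "countable (remainder X Y)" "infinite (remainder X Y)"
    using Y(2) by (auto simp: countable_point_def)
  \<comment> \<open>The infinite remainder consists of points of \<open>'a\<close>; this supplies
    the infinite type that \<open>small_sets\<close> asks for.\<close>
  have inf: "infinite (UNIV :: 'a set)"
    using K(2) rev_finite_subset[OF _ subset_UNIV] by metis
  interpret small_sets P X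
    using PQ X(1) inf by unfold_locales (auto simp: compactness_like_pair_def tychonoff_space_def)
  have YE: "Y \<in> E_set P X"
    using Y(1) by (simp add: minimal_extension_def)
  note Yp = E_set_D[OF YE]
  define K where "K = subtopology Y (remainder X Y)"
  have tK: "topspace K = remainder X Y"
    unfolding K_def by (auto simp: remainder_def)
  have "compact_space K" "Hausdorff_space K"
    unfolding K_def using Yp(1,6) by (auto simp: compact_space_subtopology Hausdorff_space_subtopology)
  then have "infinite {x. openin K {x}}"
    using infinite_isolated_points K tK by metis
  then obtain q :: "nat \<Rightarrow> 'a" where q: "inj q" "range q \<subseteq> {x. openin K {x}}"
    using infinite_countable_subset by blast
  then have qK: "openin K {q n}" for n
    by blast
  have q_rem: "q n \<in> remainder X Y" for n
    using openin_subset[OF qK[of n]] tK by simp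
  have "\<exists>f. continuous_map Y euclideanreal f \<and> f (q n) = 1 \<and> (\<forall>y\<in>remainder X Y. y \<noteq> q n \<longrightarrow> f y = 0)" for n
  proof -
    \<comment> \<open>As \<open>q n\<close> is isolated in \<open>K\<close>, which is closed in
      \<open>Y\<close>, the rest of the remainder is closed in \<open>Y\<close>, and complete
      regularity supplies \<open>h n\<close>.\<close>
    have "closedin K (remainder X Y - {q n})"
      using qK tK by (metis closedin_diff closedin_topspace)
    then have "closedin Y (remainder X Y - {q n})"
      unfolding K_def using Yp(7) closedin_trans_full by blast
    moreover have "q n \<in> topspace Y - (remainder X Y - {q n})"
      using q_rem[of n] by (simp add: remainder_def)
    ultimately obtain f where "continuous_map Y euclideanreal f" "f (q n) = 1" "f ` (remainder X Y - {q n}) \<subseteq> {0}"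
      using Yp(2) unfolding completely_regular_space_gen_alt[of 1 0, simplified] by blast
    then show ?thesis by (intro exI[of _ f]) auto
  qed
  then obtain h where h: "\<And>n. continuous_map Y euclideanreal (h n)" "\<And>n. h n (q n) = 1"
    "\<And>n y. y \<in> remainder X Y \<Longrightarrow> y \<noteq> q n \<Longrightarrow> h n y = 0"
    by metis
  interpret reduced_extension P X Y q h
    using Y(1) q(1) q_rem h by unfold_locales auto
  \<comment> \<open>Closed sets of \<open>W\<close> inside \<open>X\<close> are closed in
    \<open>X\<close> and inherit \<open>Q\<close> from it; condition (W) then reaches
    \<open>W\<close>.\<close>
  have "Q W"
  proof (rule mrowka_W_property)
    show "mrowka_W Q"
      using PQ by (simp add: compactness_like_pair_def)
    fix E assume E: "closedin W E" "E \<subseteq> topspace X"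
    have "Q (subtopology X E)"
      using PQ by (intro closed_hereditary[of Q, OF infinite_UNIV _ _ _ Hausdorff_X X(2) subtopology_W_closed(1)[OF E]])
        (auto simp: compactness_like_pair_def)
    then show "Q (subtopology W E)"
      using subtopology_W_closed(2)[OF E] by simp
  qed
  then show ?thesis
    using optimal_W tight_W compact_remainder_W countable_point_W by blast
qed

theorem theorem5p4:
  fixes P Q :: "'a topology \<Rightarrow> bool" and X :: "'a topology"
  assumes "compactness_like_pair P Q"
    and "tychonoff_space X"
    and "Q X"
  shows "((\<exists>Y. minimal_extension P X Y \<and> countable_point X Y \<and> Q Y) \<longleftrightarrow>
          (\<exists>Y. optimal_extension P X Y \<and> countable_point X Y \<and> Q Y)) \<and>
         ((\<exists>Y. optimal_extension P X Y \<and> countable_point X Y \<and> Q Y) \<longleftrightarrow>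
          (\<exists>Y. tight_extension P X Y \<and> compact_remainder X Y \<and> countable_point X Y \<and> Q Y))"
proof -
  let ?A = "\<exists>Y. minimal_extension P X Y \<and> countable_point X Y \<and> Q Y"
  let ?B = "\<exists>Y. optimal_extension P X Y \<and> countable_point X Y \<and> Q Y"
  let ?C = "\<exists>Y. tight_extension P X Y \<and> compact_remainder X Y \<and> countable_point X Y \<and> Q Y"
  \<comment> \<open>\<open>?A\<close> is the hub: it yields \<open>?B\<close> and \<open>?C\<close>
    through one and the same space, and each of them leads back to it.\<close>
  have "?B \<and> ?C" if ?A
    using that countable_point_minimal_imp_optimal_tight[OF assms] by metis
  moreover have ?A if ?B
    using that unfolding optimal_extension_def by metis
  moreover have ?A if ?C
    using that tight_imp_minimal by metis
  ultimately show ?thesis by argo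
qed

end
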